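(* Let $k \le n$ be positive integers, and let $\lambda = 1^{e_1}2^{e_2}\cdots$ be any partition of $n-k+1$ (so $e_i$ is the number of parts of $\lambda$ equal to $i$), and set $e_0 = n - e_1 - e_2 - \cdots$. Then $$\sum_{\operatorname{type} \mathbf{x}^{\mathbf{a}} = \lambda} [\mathbf{x}^{\mathbf{a}}] \prod_{j = k}^n (jx_j + x_{j+1} + \cdots + x_n) = \frac{n!\,(n-k+1)!}{e_0!(0!)^{e_0}e_1!(1!)^{e_1}e_2!(2!)^{e_2}\cdots},$$ where the sum runs over all monomials $\mathbf{x}^{\mathbf{a}} = x_1^{a_1}\cdots x_n^{a_n}$ in the variables $x_1,\ldots,x_n$ whose type is $\lambda$, and $[\mathbf{x}^{\mathbf{a}}]P$ denotes the coefficient of $\mathbf{x}^{\mathbf{a}}$ in the polynomial $P$.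
   Context: The type of a monomial $\mathbf{x}^{\mathbf{a}} = x_1^{a_1}x_2^{a_2}\cdots x_n^{a_n}$ is the partition $1^{e_1}2^{e_2}\cdots$ of its total degree $a_1+\cdots+a_n$ in which, for each $i \ge 1$, $e_i$ is the number of indices $j \in \{1,\ldots,n\}$ with $a_j = i$. *)

theory Defs
  imports Complex_Main "HOL-Library.Poly_Mapping" "HOL-Library.Multiset"
begin

text \<open>A monomial is its finitely supported exponent map, and a polynomial maps monomials to
  coefficients; the ring structure is the convolution product of \<^theory>\<open>HOL-Library.Poly_Mapping\<close>.\<close>

type_synonym monomial = "nat \<Rightarrow>\<^sub>0 nat"
type_synonym mpoly_rat = "monomial \<Rightarrow>\<^sub>0 rat"

definition var :: "nat \<Rightarrow> mpoly_rat" where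
  "var j = Poly_Mapping.single (Poly_Mapping.single j 1) 1"

abbreviation coeff_of :: "monomial \<Rightarrow> mpoly_rat \<Rightarrow> rat" where
  "coeff_of a P \<equiv> Poly_Mapping.lookup P a"

definition monomials :: "nat \<Rightarrow> monomial set" where
  "monomials n = {a. Poly_Mapping.keys a \<subseteq> {1..n}}"

text \<open>A partition is the multiset of its (positive) parts, so the number of parts equal to \<open>i\<close> is
  \<open>count lam i\<close> and the number of all parts is \<open>size lam\<close>.\<close>

definition partition_of :: "nat \<Rightarrow> nat multiset \<Rightarrow> bool" where
  "partition_of m lam \<longleftrightarrow> 0 \<notin># lam \<and> sum_mset lam = m"

definition monomial_type :: "nat \<Rightarrow> monomial \<Rightarrow> nat multiset" where
  "monomial_type n a = {# i \<in># image_mset (Poly_Mapping.lookup a) (mset_set {1..n}). i \<noteq> 0 #}"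

lemma count_monomial_type:
  assumes "i \<ge> 1"
  shows "count (monomial_type n a) i = card {j \<in> {1..n}. Poly_Mapping.lookup a j = i}"
proof -
  have "{j \<in> {1..n}. Poly_Mapping.lookup a j = i} = {j \<in> {1..n}. i = Poly_Mapping.lookup a j}"
    by auto
  then show ?thesis
    using assms by (simp add: monomial_type_def count_image_mset')
qed

lemma partition_of_monomial_type:
  "partition_of (\<Sum>j = 1..n. Poly_Mapping.lookup a j) (monomial_type n a)"
proof -
  have "sum_mset {# i \<in># M. i \<noteq> 0 #} = sum_mset M" for M :: "nat multiset"
    by (induction M) auto
  then show ?thesis
    by (simp add: partition_of_def monomial_type_def sum_unfold_sum_mset)
qed

lemma size_partition_le:
  assumes "partition_of m lam"
  shows "size lam \<le> m"
proof -
  have "0 \<notin># M \<Longrightarrow> size M \<le> sum_mset M" for M :: "nat multiset"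
    by (induction M) auto
  then show ?thesis using assms unfolding partition_of_def by blast
qed

text \<open>The index set of the sum is finite, so the sum is not the default value \<open>0\<close> of an infinite
  sum.\<close>

lemma finite_monomials_of_type: "finite {a \<in> monomials n. monomial_type n a = lam}"
proof (rule finite_imageD)
  let ?A = "{a \<in> monomials n. monomial_type n a = lam}"
  let ?F = "{f. \<forall>j. (j \<in> {1..n} \<longrightarrow> f j \<in> insert 0 (set_mset lam)) \<and> (j \<notin> {1..n} \<longrightarrow> f j = 0)}"
  have "finite ?F"
    by (intro finite_set_of_finite_funs) simp_all
  moreover have "Poly_Mapping.lookup ` ?A \<subseteq> ?F"
  proof (intro subsetI, elim imageE)
    fix f a assume f: "f = Poly_Mapping.lookup a" and a: "a \<in> ?A"
    have "f j \<in> insert 0 (set_mset lam)" if "j \<in> {1..n}" for j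
      using a that by (auto simp: f monomial_type_def)
    moreover have "f j = 0" if "j \<notin> {1..n}" for j
      using a that unfolding f monomials_def by (metis (no_types, lifting) in_keys_iff mem_Collect_eq subsetD)
    ultimately show "f \<in> ?F" by blast
  qed
  ultimately show "finite (Poly_Mapping.lookup ` ?A)"
    by (rule rev_finite_subset)
  show "inj_on Poly_Mapping.lookup ?A"
    by (rule inj_onI) (rule poly_mapping_eqI, simp)
qed

end

theory Submission
  imports Defs "HOL-Combinatorics.Transposition" "HOL-Combinatorics.Multiset_Permutations"
begin

text \<open>Let \<open>T\<close> sum the coefficients of the monomials of type \<open>lam\<close>; it is linear and invariant under
  permutations of the variables. If \<open>R\<close> is symmetric in \<open>x\<^sub>1, \<dots>, x\<^sub>k\<close>, then
  \<open>T (k x\<^sub>k R) = T ((x\<^sub>1 + \<dots> + x\<^sub>k) R)\<close>. Replacing the factors of the product one after the other,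
  starting with \<open>j = k\<close>, turns each of them into \<open>x\<^sub>1 + \<dots> + x\<^sub>n\<close> without changing the value of \<open>T\<close>, so
  that only the multinomial theorem and a count of the monomials of type \<open>lam\<close> remain.\<close>

text \<open>An \<open>update\<close> at a fresh key is the addition of a \<open>single\<close>. In
  this additive form, the induction reduces identities linear in a polynomial to single
  terms.\<close>

lemma poly_mapping_single_induct [case_names zero add]:
  fixes p :: "'a \<Rightarrow>\<^sub>0 'b::comm_monoid_add"
  assumes "P 0" and add: "\<And>a c p. P p \<Longrightarrow> P (Poly_Mapping.single a c + p)"
  shows "P p"
proof (induction p rule: update_induct)
  case (update f a b)
  then have "Poly_Mapping.update a b f = Poly_Mapping.single a b + f"
    by (intro poly_mapping_eqI)
      (auto simp: lookup_update lookup_add lookup_single when_def in_keys_iff)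
  with update add show ?case by simp
qed fact

subsection \<open>Renaming variables\<close>

lemma map_key_sum:
  assumes "inj \<sigma>"
  shows "Poly_Mapping.map_key \<sigma> (\<Sum>i\<in>I. p i) = (\<Sum>i\<in>I. Poly_Mapping.map_key \<sigma> (p i))"
  by (induction I rule: infinite_finite_induct) (simp_all add: assms map_key_plus)

text \<open>Both sides are additive in each factor, so products of single terms suffice.
  \<open>map_key\<close> moves a term to the preimage of its key, which for an involution is the
  image; additivity of \<open>\<sigma>\<close> then matches the keys.\<close>

lemma map_key_mult:
  fixes p q :: "'a::comm_monoid_add \<Rightarrow>\<^sub>0 'b::comm_semiring_0"
  assumes invol: "\<And>a. \<sigma> (\<sigma> a) = a" and additive: "\<And>a b. \<sigma> (a + b) = \<sigma> a + \<sigma> b"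
  shows "Poly_Mapping.map_key \<sigma> (p * q) = Poly_Mapping.map_key \<sigma> p * Poly_Mapping.map_key \<sigma> q"
proof -
  have inj: "inj \<sigma>" by (metis injI invol)
  have single: "Poly_Mapping.map_key \<sigma> (Poly_Mapping.single a c) = Poly_Mapping.single (\<sigma> a) c"
    for a and c :: 'b
    using map_key_single[OF inj, of "\<sigma> a" c] by (simp add: invol)
  have "Poly_Mapping.map_key \<sigma> (Poly_Mapping.single a c * q) =
      Poly_Mapping.map_key \<sigma> (Poly_Mapping.single a c) * Poly_Mapping.map_key \<sigma> q" for a c
    by (induction q rule: poly_mapping_single_induct)
      (simp_all add: inj distrib_left map_key_plus mult_single single additive)
  then show ?thesis
    by (induction p rule: poly_mapping_single_induct) (simp_all add: inj distrib_right map_key_plus)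
qed

definition swap_monomial :: "nat \<Rightarrow> nat \<Rightarrow> monomial \<Rightarrow> monomial" where
  "swap_monomial i k = Poly_Mapping.map_key (transpose i k)"

text \<open>\<open>map_key\<close> precomposes. As transpositions are involutions, this agrees with
  substituting the two variables for each other.\<close>

definition swap_vars :: "nat \<Rightarrow> nat \<Rightarrow> mpoly_rat \<Rightarrow> mpoly_rat" where
  "swap_vars i k = Poly_Mapping.map_key (swap_monomial i k)"

lemma lookup_swap_monomial [simp]:
  "Poly_Mapping.lookup (swap_monomial i k a) j = Poly_Mapping.lookup a (transpose i k j)"
  by (simp add: swap_monomial_def map_key.rep_eq)

lemma swap_monomial_swap_monomial [simp]: "swap_monomial i k (swap_monomial i k a) = a"
  by (intro poly_mapping_eqI) simp

lemma inj_swap_monomial: "inj (swap_monomial i k)"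
  by (metis injI swap_monomial_swap_monomial)

lemma lookup_swap_vars: "coeff_of a (swap_vars i k P) = coeff_of (swap_monomial i k a) P"
  by (simp add: swap_vars_def map_key.rep_eq inj_swap_monomial)

lemma swap_monomial_add: "swap_monomial i k (a + b) = swap_monomial i k a + swap_monomial i k b"
  by (simp add: swap_monomial_def map_key_plus)

lemma swap_vars_mult: "swap_vars i k (P * Q) = swap_vars i k P * swap_vars i k Q"
  unfolding swap_vars_def
  by (rule map_key_mult) (simp_all add: swap_monomial_add)

lemma swap_vars_add: "swap_vars i k (P + Q) = swap_vars i k P + swap_vars i k Q"
  by (simp add: swap_vars_def map_key_plus inj_swap_monomial)

lemma swap_vars_sum: "swap_vars i k (\<Sum>j\<in>I. P j) = (\<Sum>j\<in>I. swap_vars i k (P j))"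
  by (simp add: swap_vars_def map_key_sum inj_swap_monomial)

lemma swap_monomial_single:
  "swap_monomial i k (Poly_Mapping.single (transpose i k j) c) = Poly_Mapping.single j c"
  by (simp add: swap_monomial_def)

lemma swap_vars_single:
  "swap_vars i k (Poly_Mapping.single a c) = Poly_Mapping.single (swap_monomial i k a) c"
  using map_key_single[OF inj_swap_monomial, of i k "swap_monomial i k a" c]
  by (simp add: swap_vars_def)

lemma swap_vars_var: "swap_vars i k (var j) = var (transpose i k j)"
  using swap_monomial_single[of i k "transpose i k j" 1]
  by (simp add: var_def swap_vars_single)

lemma swap_vars_one [simp]: "swap_vars i k 1 = 1"
proof -
  have "swap_monomial i k 0 = 0" by (intro poly_mapping_eqI) simp
  then show ?thesis using swap_vars_single[of i k 0 1] by simp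
qed

lemma swap_vars_of_nat [simp]: "swap_vars i k (of_nat m) = of_nat m"
proof (induction m)
  case 0
  then show ?case by (simp add: swap_vars_def inj_swap_monomial)
qed (simp add: swap_vars_add)

lemma swap_vars_prod: "swap_vars i k (\<Prod>j\<in>I. P j) = (\<Prod>j\<in>I. swap_vars i k (P j))"
  by (induction I rule: infinite_finite_induct) (simp_all add: swap_vars_mult)

lemma swap_vars_power: "swap_vars i k (P ^ r) = swap_vars i k P ^ r"
  by (induction r) (simp_all add: swap_vars_mult)

lemma swap_vars_sum_var:
  assumes "i \<in> I \<longleftrightarrow> k \<in> I"
  shows "swap_vars i k (\<Sum>j\<in>I. var j) = (\<Sum>j\<in>I. var j)"
proof -
  have "(\<Sum>j\<in>I. var (transpose i k j)) = (\<Sum>j\<in>I. var j)"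
    using sum.reindex[of "transpose i k" I var] assms by simp
  then show ?thesis by (simp only: swap_vars_sum swap_vars_var)
qed

subsection \<open>Sums of coefficients over a monomial type\<close>

text \<open>The functional \<open>T\<close> of the introductory text.\<close>

definition type_sum :: "nat \<Rightarrow> nat multiset \<Rightarrow> mpoly_rat \<Rightarrow> rat" where
  "type_sum n lam P = (\<Sum>a \<in> {a \<in> monomials n. monomial_type n a = lam}. coeff_of a P)"

lemma type_sum_add: "type_sum n lam (P + Q) = type_sum n lam P + type_sum n lam Q"
  by (simp add: type_sum_def lookup_add sum.distrib)

lemma type_sum_sum: "type_sum n lam (\<Sum>i\<in>I. P i) = (\<Sum>i\<in>I. type_sum n lam (P i))"
  unfolding type_sum_def lookup_sum by (rule sum.swap)

lemma type_sum_of_nat_mult: "type_sum n lam (of_nat m * P) = of_nat m * type_sum n lam P"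
proof (induction m)
  case 0
  then show ?case by (simp add: type_sum_def)
qed (simp add: distrib_right type_sum_add)

text \<open>Exchanging two exponents keeps their multiset, hence the type, so the swap merely
  permutes the summands.\<close>

lemma type_sum_swap_vars:
  assumes "i \<in> {1..n}" and "k \<in> {1..n}"
  shows "type_sum n lam (swap_vars i k P) = type_sum n lam P"
proof -
  let ?A = "{a \<in> monomials n. monomial_type n a = lam}"
  have mono: "swap_monomial i k a \<in> ?A" if "a \<in> ?A" for a
  proof -
    have "image_mset (Poly_Mapping.lookup a) (image_mset (transpose i k) (mset_set {1..n})) =
        image_mset (Poly_Mapping.lookup a) (mset_set {1..n})"
      using assms by (subst image_mset_mset_set) simp_all
    moreover have "Poly_Mapping.lookup (swap_monomial i k a) = Poly_Mapping.lookup a \<circ> transpose i k"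
      by auto
    ultimately have "monomial_type n (swap_monomial i k a) = monomial_type n a"
      by (simp only: monomial_type_def multiset.map_comp)
    moreover have "j \<in> {1..n}" if "j \<in> Poly_Mapping.keys (swap_monomial i k a)" for j
    proof -
      have "transpose i k j \<in> Poly_Mapping.keys a"
        using that by (simp add: in_keys_iff)
      then have "transpose i k j \<in> {1..n}"
        using \<open>a \<in> ?A\<close> by (auto simp: monomials_def)
      then show ?thesis using assms by (auto simp: transpose_def split: if_splits)
    qed
    ultimately show ?thesis using that by (auto simp: monomials_def)
  qed
  show ?thesis
    unfolding type_sum_def lookup_swap_vars
    \<comment> \<open>The swap is its own inverse and serves as the witness in both directions, so
      closure of \<open>?A\<close> under it is enough.\<close>
    by (rule sum.reindex_bij_witness[of _ "swap_monomial i k" "swap_monomial i k"]) (use mono in auto)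
qed

text \<open>Swapping \<open>i\<close> and \<open>k\<close> fixes \<open>R\<close>, so all
  \<open>var i * R\<close> with \<open>i \<le> k\<close> have the same type sum. Hence
  \<open>k\<close> copies of \<open>var k\<close> can be traded for the sum of the first
  \<open>k\<close> variables.\<close>

lemma type_sum_replace_factor:
  assumes "1 \<le> k" and "k \<le> n"
    and sym: "\<And>i. i \<in> {1..k} \<Longrightarrow> swap_vars i k R = R"
  shows "type_sum n lam ((of_nat k * var k + (\<Sum>i = k + 1..n. var i)) * R) =
    type_sum n lam ((\<Sum>i = 1..n. var i) * R)"
proof -
  have eq: "type_sum n lam (var i * R) = type_sum n lam (var k * R)" if "i \<in> {1..k}" for i
  proof -
    have "type_sum n lam (var i * R) = type_sum n lam (swap_vars i k (var i * R))"
      using assms that by (subst type_sum_swap_vars) auto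
    also have "swap_vars i k (var i * R) = var k * R"
      using that by (simp add: swap_vars_mult swap_vars_var sym)
    finally show ?thesis .
  qed
  have "(\<Sum>i = 1..n. var i) = (\<Sum>i = 1..k. var i) + (\<Sum>i = k + 1..n. var i)"
    using sum.ub_add_nat[of 1 k var "n - k"] assms by simp
  moreover have "type_sum n lam ((\<Sum>i = 1..k. var i) * R) = type_sum n lam (of_nat k * var k * R)"
  proof -
    have "type_sum n lam ((\<Sum>i = 1..k. var i) * R) = (\<Sum>i = 1..k. type_sum n lam (var i * R))"
      by (simp only: sum_distrib_right type_sum_sum)
    also have "\<dots> = (\<Sum>i = 1..k. type_sum n lam (var k * R))"
      by (rule sum.cong[OF refl eq])
    finally show ?thesis by (simp add: type_sum_of_nat_mult mult.assoc)
  qed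
  ultimately show ?thesis by (simp add: distrib_right type_sum_add)
qed

text \<open>The exponent \<open>r\<close> counts the factors already replaced. The induction
  descends from \<open>k = n + 1\<close>, where the product is empty; each step replaces the factor
  \<open>j = k\<close> and passes to \<open>Suc k\<close> and \<open>Suc r\<close>.\<close>

lemma type_sum_prod:
  assumes "1 \<le> k" and "k \<le> n + 1"
  shows "type_sum n lam ((\<Prod>j = k..n. of_nat j * var j + (\<Sum>i = j + 1..n. var i)) *
      (\<Sum>i = 1..n. var i) ^ r) =
    type_sum n lam ((\<Sum>i = 1..n. var i) ^ (n + 1 - k + r))"
  using assms(2,1)
proof (induction k arbitrary: r rule: inc_induct)
  case base
  then show ?case by simp
next
  case (step k)
  let ?S = "\<Sum>i = 1..n. var i"
  let ?L = "\<lambda>j. of_nat j * var j + (\<Sum>i = j + 1..n. var i)"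
  let ?R = "(\<Prod>j = Suc k..n. ?L j) * ?S ^ r"
  have k: "1 \<le> k" "k \<le> n" using step by auto
  have "swap_vars i k ?R = ?R" if "i \<in> {1..k}" for i
  proof -
    \<comment> \<open>The factor for \<open>j\<close> involves only variables of index at least
      \<open>j\<close>, while \<open>i \<le> k < j\<close>.\<close>
    have "swap_vars i k (?L j) = ?L j" if "j \<in> {Suc k..n}" for j
      using that \<open>i \<in> {1..k}\<close> swap_vars_sum_var[of i "{j + 1..n}" k]
      by (simp add: swap_vars_add swap_vars_mult swap_vars_var)
    then have "swap_vars i k (\<Prod>j = Suc k..n. ?L j) = (\<Prod>j = Suc k..n. ?L j)"
      unfolding swap_vars_prod by (rule prod.cong[OF refl])
    moreover have "swap_vars i k ?S = ?S"
      using that k by (intro swap_vars_sum_var) auto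
    ultimately show ?thesis
      by (simp only: swap_vars_mult swap_vars_power)
  qed
  then have "type_sum n lam (?L k * ?R) = type_sum n lam (?S * ?R)"
    by (rule type_sum_replace_factor[OF k])
  moreover have "(\<Prod>j = k..n. ?L j) = ?L k * (\<Prod>j = Suc k..n. ?L j)"
    using k by (intro prod.atLeast_Suc_atMost)
  ultimately have "type_sum n lam ((\<Prod>j = k..n. ?L j) * ?S ^ r) =
      type_sum n lam ((\<Prod>j = Suc k..n. ?L j) * ?S ^ Suc r)"
    by (simp only: mult.assoc mult.left_commute power_Suc)
  also have "\<dots> = type_sum n lam (?S ^ (n + 1 - Suc k + Suc r))"
    using k by (intro step.IH) auto
  finally show ?case using k by (simp add: Suc_diff_le)
qed

subsection \<open>Multinomial coefficients and the number of monomials of a type\<close>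

text \<open>By cancellation, only the term of \<open>q\<close> at \<open>b\<close> is shifted to
  \<open>a + b\<close>.\<close>

lemma lookup_single_mult:
  fixes q :: "'a::cancel_comm_monoid_add \<Rightarrow>\<^sub>0 'b::comm_semiring_0"
  shows "Poly_Mapping.lookup (Poly_Mapping.single a c * q) (a + b) = c * Poly_Mapping.lookup q b"
  by (induction q rule: poly_mapping_single_induct)
    (auto simp: distrib_left lookup_add mult_single lookup_single when_def)

lemma lookup_var_mult_eq_0:
  assumes "Poly_Mapping.lookup a i = 0"
  shows "coeff_of a (var i * Q) = 0"
proof -
  have "Poly_Mapping.single i 1 + b \<noteq> a" for b
    using assms by (auto simp: lookup_add)
  then show ?thesis
    by (induction Q rule: poly_mapping_single_induct)
      (auto simp: distrib_left lookup_add mult_single lookup_single when_def var_def)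
qed

text \<open>The multinomial theorem with denominators cleared. Splitting off one factor of the
  power, the summand for \<open>var i\<close> contributes the exponent of \<open>i\<close> times
  \<open>fact m\<close>, and the exponents add up to \<open>Suc m\<close>.\<close>

lemma lookup_sum_var_power:
  assumes "a \<in> monomials n" and "(\<Sum>j = 1..n. Poly_Mapping.lookup a j) = m"
  shows "coeff_of a ((\<Sum>i = 1..n. var i) ^ m) * (\<Prod>j = 1..n. fact (Poly_Mapping.lookup a j)) = fact m"
  using assms
proof (induction m arbitrary: a)
  case 0
  have "Poly_Mapping.lookup a j = 0" for j
    using 0 by (cases "j \<in> {1..n}") (auto simp: monomials_def in_keys_iff)
  then have "a = 0" by (intro poly_mapping_eqI) simp
  then show ?case by simp
next
  case (Suc m)
  let ?S = "\<Sum>i = 1..n. var i"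
  let ?F = "\<lambda>a. \<Prod>j = 1..n. fact (Poly_Mapping.lookup a j) :: rat"
  have summand: "coeff_of a (var i * ?S ^ m) * ?F a = of_nat (Poly_Mapping.lookup a i) * fact m"
    if i: "i \<in> {1..n}" for i
  proof (cases "Poly_Mapping.lookup a i = 0")
    case True
    then show ?thesis by (simp add: lookup_var_mult_eq_0)
  next
    case False
    \<comment> \<open>Division by \<open>var i\<close>: the truncated subtraction is exact since the
      exponent of \<open>i\<close> is positive.\<close>
    define b where "b = a - Poly_Mapping.single i 1"
    have a: "a = Poly_Mapping.single i 1 + b"
      using False by (intro poly_mapping_eqI) (auto simp: b_def lookup_add lookup_minus lookup_single when_def)
    have "b \<in> monomials n"
      using Suc.prems by (auto simp: b_def monomials_def in_keys_iff lookup_minus)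
    moreover have "(\<Sum>j = 1..n. Poly_Mapping.lookup b j) = m"
      using Suc.prems i by (simp add: a lookup_add lookup_single sum.distrib when_def)
    ultimately have IH: "coeff_of b (?S ^ m) * ?F b = fact m"
      by (rule Suc.IH)
    have "?F a = fact (Poly_Mapping.lookup a i) * (\<Prod>j \<in> {1..n} - {i}. fact (Poly_Mapping.lookup a j))"
      using i by (simp add: prod.remove)
    also have "(\<Prod>j \<in> {1..n} - {i}. fact (Poly_Mapping.lookup a j) :: rat) =
        (\<Prod>j \<in> {1..n} - {i}. fact (Poly_Mapping.lookup b j))"
      by (intro prod.cong) (auto simp: a lookup_add lookup_single)
    also have "fact (Poly_Mapping.lookup a i) =
        of_nat (Poly_Mapping.lookup a i) * (fact (Poly_Mapping.lookup b i) :: rat)"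
      by (simp add: a lookup_add)
    also have "\<dots> * (\<Prod>j \<in> {1..n} - {i}. fact (Poly_Mapping.lookup b j)) =
        of_nat (Poly_Mapping.lookup a i) * ?F b"
      using i by (simp add: prod.remove mult.assoc)
    finally have "?F a = of_nat (Poly_Mapping.lookup a i) * ?F b" .
    moreover have "coeff_of a (var i * ?S ^ m) = coeff_of b (?S ^ m)"
      using lookup_single_mult[of "Poly_Mapping.single i 1" 1 "?S ^ m" b] by (simp add: var_def a)
    ultimately show ?thesis using IH by simp
  qed
  have "coeff_of a (?S ^ Suc m) * ?F a = (\<Sum>i = 1..n. coeff_of a (var i * ?S ^ m) * ?F a)"
    by (simp add: sum_distrib_right lookup_sum)
  also have "\<dots> = of_nat (\<Sum>i = 1..n. Poly_Mapping.lookup a i) * fact m"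
    by (simp only: sum.cong[OF refl summand] of_nat_sum sum_distrib_right)
  also have "\<dots> = fact (Suc m)"
    using Suc.prems by simp
  finally show ?case .
qed

text \<open>The type forgets zero exponents, which is harmless because
  \<open>fact 0 = 1\<close>.\<close>

lemma prod_fact_monomial_type:
  "(\<Prod>j = 1..n. fact (Poly_Mapping.lookup a j)) = (\<Prod>i\<in>#monomial_type n a. fact i :: rat)"
proof -
  have "(\<Prod>i\<in>#{#i \<in># M. i \<noteq> 0#}. fact i) = (\<Prod>i\<in>#M. fact i :: rat)" for M :: "nat multiset"
    by (induction M) auto
  then show ?thesis
    by (simp add: monomial_type_def prod_unfold_prod_mset multiset.map_comp o_def)
qed

text \<open>Listing the exponents of \<open>1, ..., n\<close> identifies these monomials with the
  arrangements of the parts of \<open>lam\<close> padded by zeros to length \<open>n\<close>. The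
  statement is the count of multiset permutations.\<close>

lemma card_monomials_of_type:
  assumes "0 \<notin># lam" and "size lam \<le> n"
  shows "card {a \<in> monomials n. monomial_type n a = lam} *
    (fact (n - size lam) * (\<Prod>i\<in>set_mset lam. fact (count lam i))) = fact n"
proof -
  let ?A = "{a \<in> monomials n. monomial_type n a = lam}"
  define M where "M = lam + replicate_mset (n - size lam) 0"
  define exps where "exps a = map (Poly_Mapping.lookup a) [1..<n + 1]" for a :: monomial
  have mset_exps: "mset (exps a) = image_mset (Poly_Mapping.lookup a) (mset_set {1..n})" for a
    by (simp add: exps_def atLeastLessThanSuc_atLeastAtMost del: upt_Suc)
  have filter_M: "filter_mset (\<lambda>i. i \<noteq> 0) M = lam"
    using assms by (auto simp: M_def multiset_eq_iff count_eq_zero_iff)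
  \<comment> \<open>Consequently the nonzero entries and the size determine a multiset.\<close>
  have split: "N = filter_mset (\<lambda>i. i \<noteq> 0) N + replicate_mset (count N 0) 0" for N :: "nat multiset"
    by (rule multiset_eqI) auto
  have "bij_betw exps ?A (permutations_of_multiset M)"
  proof (rule bij_betw_imageI)
    show "inj_on exps ?A"
    proof (intro inj_onI poly_mapping_eqI)
      fix a b j assume a: "a \<in> ?A" and b: "b \<in> ?A" and "exps a = exps b"
      then have "\<forall>j \<in> {1..n}. Poly_Mapping.lookup a j = Poly_Mapping.lookup b j"
        by (auto simp: exps_def)
      moreover have "Poly_Mapping.lookup a j = 0 \<and> Poly_Mapping.lookup b j = 0" if "j \<notin> {1..n}"
        using a b that by (auto simp: monomials_def in_keys_iff)
      ultimately show "Poly_Mapping.lookup a j = Poly_Mapping.lookup b j" by fastforce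
    qed
    show "exps ` ?A = permutations_of_multiset M"
    proof (intro equalityI subsetI)
      fix xs assume "xs \<in> exps ` ?A"
      then obtain a where xs: "xs = exps a" and a: "a \<in> ?A" by auto
      have lam: "filter_mset (\<lambda>i. i \<noteq> 0) (mset xs) = lam"
        using a by (simp add: xs mset_exps monomial_type_def)
      have xs_eq: "mset xs = lam + replicate_mset (count (mset xs) 0) 0"
        using split[of "mset xs"] unfolding lam .
      have "length xs = n" by (simp add: xs exps_def)
      then have "count (mset xs) 0 = n - size lam"
        using arg_cong[OF xs_eq, of size] by simp
      then show "xs \<in> permutations_of_multiset M"
        using xs_eq by (simp add: M_def permutations_of_multiset_def)
    next
      fix xs assume xs: "xs \<in> permutations_of_multiset M"
      then have mset: "mset xs = M" by (simp add: permutations_of_multiset_def)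
      have len: "length xs = n"
        using arg_cong[OF mset, of size] assms by (simp add: M_def)
      \<comment> \<open>The inverse of \<open>exps\<close>: variables are numbered from 1, list
        positions from 0. The default 0 gives finite support inside \<open>{1..n}\<close>.\<close>
      define f where "f j = (if j \<in> {1..n} then xs ! (j - 1) else 0)" for j
      define a where "a = Abs_poly_mapping f"
      have "finite {j. f j \<noteq> 0}"
        by (rule finite_subset[of _ "{1..n}"]) (auto simp: f_def)
      then have lookup: "Poly_Mapping.lookup a = f"
        by (simp add: a_def)
      have exps: "exps a = xs"
        by (intro nth_equalityI) (auto simp: exps_def len lookup f_def simp del: upt_Suc)
      moreover have "a \<in> monomials n"
        by (auto simp: monomials_def in_keys_iff lookup f_def split: if_splits)
      moreover have "monomial_type n a = lam"
        unfolding monomial_type_def mset_exps[symmetric] exps mset by (rule filter_M)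
      ultimately show "xs \<in> exps ` ?A" by blast
    qed
  qed
  then have card: "card ?A = card (permutations_of_multiset M)"
    by (rule bij_betw_same_card)
  \<comment> \<open>Without padding, 0 is not in \<open>M\<close>, but inserting it only adds the
    factor \<open>fact 0 = 1\<close>.\<close>
  have "(\<Prod>i\<in>set_mset M. fact (count M i) :: nat) =
      (\<Prod>i\<in>insert 0 (set_mset lam). fact (count M i))"
    by (intro prod.mono_neutral_left) (auto simp: M_def not_in_iff)
  also have "\<dots> = fact (count M 0) * (\<Prod>i\<in>set_mset lam. fact (count M i))"
    using assms by simp
  also have "count M 0 = n - size lam"
    using assms by (simp add: M_def not_in_iff)
  also have "(\<Prod>i\<in>set_mset lam. fact (count M i) :: nat) = (\<Prod>i\<in>set_mset lam. fact (count lam i))"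
    using assms by (intro prod.cong) (auto simp: M_def)
  finally have prod_M: "(\<Prod>i\<in>set_mset M. fact (count M i)) =
      fact (n - size lam) * (\<Prod>i\<in>set_mset lam. fact (count lam i) :: nat)" .
  have "size M = n" using assms by (simp add: M_def)
  then show ?thesis
    using card_permutations_of_multiset_aux[of M] by (simp add: card prod_M)
qed

theorem theorem1:
  fixes k n :: nat and lam :: "nat multiset"
  assumes "1 \<le> k" and "k \<le> n"
    and "partition_of (n - k + 1) lam"
  shows "(\<Sum>a \<in> {a \<in> monomials n. monomial_type n a = lam}.
            coeff_of a (\<Prod>j = k..n. of_nat j * var j + (\<Sum>i = j + 1..n. var i)))
         = fact n * fact (n - k + 1) /
           (fact (n - size lam) * fact 0 ^ (n - size lam) *
            (\<Prod>i = 1..n - k + 1. fact (count lam i) * fact i ^ count lam i))"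
proof -
  let ?m = "n - k + 1"
  let ?A = "{a \<in> monomials n. monomial_type n a = lam}"
  let ?c = "\<Prod>i\<in>#lam. fact i :: rat"
  let ?e = "\<Prod>i\<in>set_mset lam. fact (count lam i) :: rat"
  have lam: "0 \<notin># lam" "sum_mset lam = ?m"
    using assms(3) by (simp_all add: partition_of_def)
  have size: "size lam \<le> n"
    using size_partition_le[OF assms(3)] assms(1,2) by simp
  have c: "?c \<noteq> 0"
    by (auto simp: prod_mset_zero_iff)
  \<comment> \<open>The coefficient depends on the type alone, so the type sum is a cardinality
    times a constant.\<close>
  have "coeff_of a ((\<Sum>i = 1..n. var i) ^ ?m) = fact ?m / ?c" if "a \<in> ?A" for a
  proof -
    have "(\<Sum>j = 1..n. Poly_Mapping.lookup a j) = ?m"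
      using partition_of_monomial_type[where n = n and a = a] that lam(2) by (simp add: partition_of_def)
    then have "coeff_of a ((\<Sum>i = 1..n. var i) ^ ?m) * ?c = fact ?m"
      using lookup_sum_var_power[of a n ?m] that by (simp only: prod_fact_monomial_type mem_Collect_eq)
    then show ?thesis using c by (simp add: field_simps)
  qed
  then have "type_sum n lam ((\<Sum>i = 1..n. var i) ^ ?m) = of_nat (card ?A) * (fact ?m / ?c)"
    by (simp add: type_sum_def)
  moreover have "type_sum n lam (\<Prod>j = k..n. of_nat j * var j + (\<Sum>i = j + 1..n. var i)) =
      type_sum n lam ((\<Sum>i = 1..n. var i) ^ ?m)"
    using type_sum_prod[of k n lam 0] assms(1,2) by (simp add: Suc_diff_le)
  moreover have "of_nat (card ?A) = fact n / (fact (n - size lam) * ?e)"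
    using arg_cong[OF card_monomials_of_type[OF lam(1) size], of "of_nat :: nat \<Rightarrow> rat"]
    by (simp add: eq_divide_eq)
  \<comment> \<open>All parts lie in \<open>{1..?m}\<close>, and an index that is not a part
    contributes 1. The powers of \<open>fact i\<close> then collect into the product over the
    multiset \<open>lam\<close>.\<close>
  moreover have "(\<Prod>i = 1..?m. fact (count lam i) * fact i ^ count lam i) = ?e * ?c"
  proof -
    have "i \<in> {1..?m}" if "i \<in># lam" for i
    proof -
      have "i \<noteq> 0" using that lam(1) by metis
      moreover have "i \<le> sum_mset lam" using that by (auto dest: multi_member_split)
      ultimately show ?thesis using lam(2) by simp
    qed
    then have "(\<Prod>i = 1..?m. fact (count lam i) * fact i ^ count lam i :: rat) =
        (\<Prod>i\<in>set_mset lam. fact (count lam i) * fact i ^ count lam i)"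
      by (intro prod.mono_neutral_right) (auto simp: not_in_iff)
    then show ?thesis
      by (simp add: prod.distrib image_prod_mset_multiplicity)
  qed
  ultimately show ?thesis
    by (simp only: fact_0 power_one mult_1_right times_divide_times_eq mult.assoc flip: type_sum_def)
qed

end
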